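(* Let $n\ge 2$ and $a\ge 2$ be integers and set $\alpha=1-1/a$. Consider a deck of $n$ cards with the ace of spades (a distinguished card) at the bottom. For $1\le i\le n$ let $Q_a(i)$ be the probability that the ace of spades is at position $i$ from the top after an $a$-shuffle. Then the total variation distance $\frac12\sum_{i=1}^{n}\big|Q_a(i)-\frac1n\big|$ is at most $$\frac{\alpha^{n+1}}{1-\alpha^n}-\frac{a\alpha^2(1-\alpha^{n-1})}{n(1-\alpha^n)}+\frac{1}{n\log(1/\alpha)}\log\left(\frac an\,\frac{1-\alpha^n}{\alpha^{n+1}}\right),$$ and at least $$\frac{\alpha^n}{1-\alpha^{n-1}}-\frac{a(1-\alpha^n)}{n\alpha(1-\alpha^{n-1})}+\frac{1}{n\log(1/\alpha)}\log\left(\frac an\,\frac{1-\alpha^{n-1}}{\alpha^{n-1}}\right).$$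
   Context: $\log$ is the natural logarithm. $a$-shuffle of $n$ cards: the deck is cut into $a$ consecutive packets of sizes $A_1,\dots,A_a\ge 0$ (packet $1$ on top, empty packets allowed), $A_1+\cdots+A_a=n$, with probability $a^{-n}\binom{n}{A_1,\dots,A_a}$; the packets are then riffled together by dropping cards one at a time from the bottoms of the packets, the next card coming from a given packet with probability proportional to its current size (equivalently, all interleavings preserving the order within each packet are equally likely). *)

theory Defs
  imports "HOL-Probability.Probability"
begin

text \<open>
  A deck is a list of cards whose head is the top card. A list of packet sizes or of packets
  has the topmost packet first; packets may be empty.
\<close>

definition packet_sizes :: "nat \<Rightarrow> nat \<Rightarrow> nat list set" where
  "packet_sizes a n = {A. length A = a \<and> sum_list A = n}"

definition cut_sizes :: "nat \<Rightarrow> nat \<Rightarrow> nat list pmf" where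
  "cut_sizes a n = embed_pmf (\<lambda>A. if A \<in> packet_sizes a n
     then fact n / (\<Prod>k\<leftarrow>A. fact k) / real a ^ n else 0)"

primrec cut :: "nat list \<Rightarrow> 'c list \<Rightarrow> 'c list list" where
  "cut [] d = []"
| "cut (k # A) d = take k d # cut A (drop k d)"

text \<open>
  The index of the packet from which the next card falls. This is meaningful only as long as
  some packet is nonempty.
\<close>

definition drop_index :: "'c list list \<Rightarrow> nat pmf" where
  "drop_index ps = embed_pmf (\<lambda>j. if j < length ps
     then real (length (ps ! j)) / real (\<Sum>p\<leftarrow>ps. length p) else 0)"

text \<open>
  \<open>riffle m ps d\<close> drops \<open>m\<close> further cards from the packets \<open>ps\<close> onto the pile \<open>d\<close>. The bottom
  card of a packet is its last element, and it lands on top of the pile.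
\<close>

primrec riffle :: "nat \<Rightarrow> 'c list list \<Rightarrow> 'c list \<Rightarrow> 'c list pmf" where
  "riffle 0 ps d = return_pmf d"
| "riffle (Suc m) ps d =
     bind_pmf (drop_index ps) (\<lambda>j. riffle m (ps[j := butlast (ps ! j)]) (last (ps ! j) # d))"

definition a_shuffle :: "nat \<Rightarrow> 'c list \<Rightarrow> 'c list pmf" where
  "a_shuffle a d = bind_pmf (cut_sizes a (length d)) (\<lambda>A. riffle (length d) (cut A d) [])"

text \<open>Positions are counted from the top, starting with \<open>1\<close>.\<close>

definition position_prob :: "nat \<Rightarrow> 'c list \<Rightarrow> 'c \<Rightarrow> nat \<Rightarrow> real" where
  "position_prob a d c i = measure_pmf.prob (a_shuffle a d) {e. e ! (i - 1) = c}"

text \<open>The weights given to \<^const>\<open>embed_pmf\<close> above do sum to \<open>1\<close>, so that they are the mass functions.\<close>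

lemma packet_sizes_0: "packet_sizes 0 n = (if n = 0 then {[]} else {})"
  by (auto simp: packet_sizes_def)

lemma packet_sizes_Suc:
  "packet_sizes (Suc a) n = (\<lambda>(k, A). k # A) ` (SIGMA k:{..n}. packet_sizes a (n - k))"
proof (intro equalityI subsetI)
  fix B assume "B \<in> packet_sizes (Suc a) n"
  then obtain k A where "B = k # A" "length A = a" "k + sum_list A = n"
    by (auto simp: packet_sizes_def length_Suc_conv)
  then show "B \<in> (\<lambda>(k, A). k # A) ` (SIGMA k:{..n}. packet_sizes a (n - k))"
    by (intro image_eqI[of _ _ "(k, A)"]) (auto simp: packet_sizes_def)
qed (auto simp: packet_sizes_def)

lemma finite_packet_sizes: "finite (packet_sizes a n)"
proof (induction a arbitrary: n)
  case (Suc a)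
  then show ?case unfolding packet_sizes_Suc by (intro finite_imageI finite_SigmaI) auto
qed (simp add: packet_sizes_0)

lemma sum_multinomial:
  "(\<Sum>A\<in>packet_sizes a n. fact n / (\<Prod>k\<leftarrow>A. fact k)) = real a ^ n"
proof (induction a arbitrary: n)
  case 0
  then show ?case by (simp add: packet_sizes_0 power_0_left)
next
  case (Suc a)
  have "(\<Sum>A\<in>packet_sizes (Suc a) n. fact n / (\<Prod>k\<leftarrow>A. fact k)) =
      (\<Sum>(k, A)\<in>(SIGMA k:{..n}. packet_sizes a (n - k)).
         fact n / (fact k * (\<Prod>k\<leftarrow>A. fact k)) :: real)"
    unfolding packet_sizes_Suc
    by (subst sum.reindex) (auto simp: inj_on_def intro!: sum.cong)
  also have "\<dots> = (\<Sum>k\<le>n. \<Sum>A\<in>packet_sizes a (n - k). fact n / (fact k * (\<Prod>k\<leftarrow>A. fact k)))"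
    by (subst sum.Sigma) (auto simp: finite_packet_sizes)
  also have "\<dots> = (\<Sum>k\<le>n. real (n choose k) *
      (\<Sum>A\<in>packet_sizes a (n - k). fact (n - k) / (\<Prod>k\<leftarrow>A. fact k)))"
    by (intro sum.cong refl) (simp add: sum_distrib_left binomial_fact)
  also have "\<dots> = (\<Sum>k\<le>n. real (n choose k) * 1 ^ k * real a ^ (n - k))"
    by (simp add: Suc.IH)
  also have "\<dots> = (1 + real a) ^ n"
    by (subst binomial_ring) (simp add: mult.assoc)
  finally show ?case by simp
qed

lemma pmf_cut_sizes:
  assumes "a > 0"
  shows "pmf (cut_sizes a n) A =
    (if A \<in> packet_sizes a n then fact n / (\<Prod>k\<leftarrow>A. fact k) / real a ^ n else 0)"
proof -
  let ?f = "\<lambda>A. if A \<in> packet_sizes a n then fact n / (\<Prod>k\<leftarrow>A. fact k) / real a ^ n else 0"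
  have pos: "(\<Prod>k\<leftarrow>B. fact k) \<ge> (0 :: real)" for B :: "nat list"
    by (induction B) auto
  have nn: "?f B \<ge> 0" for B
    using pos by auto
  have "(\<integral>\<^sup>+B. ennreal (?f B) \<partial>count_space UNIV) = (\<Sum>B\<in>packet_sizes a n. ennreal (?f B))"
    by (intro nn_integral_count_space') (auto simp: finite_packet_sizes)
  also have "\<dots> = ennreal (\<Sum>B\<in>packet_sizes a n. ?f B)"
    by (intro sum_ennreal nn)
  also have "(\<Sum>B\<in>packet_sizes a n. ?f B) = 1"
    using assms sum_multinomial[of n a] by (simp flip: sum_divide_distrib del: divide_divide_eq_left)
  finally show ?thesis
    unfolding cut_sizes_def by (subst pmf_embed_pmf) (use nn in auto)
qed

lemma pmf_drop_index:
  assumes "(\<Sum>p\<leftarrow>ps. length p) > 0"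
  shows "pmf (drop_index ps) j =
    (if j < length ps then real (length (ps ! j)) / real (\<Sum>p\<leftarrow>ps. length p) else 0)"
proof -
  let ?f = "\<lambda>j. if j < length ps then real (length (ps ! j)) / real (\<Sum>p\<leftarrow>ps. length p) else 0"
  have nn: "?f j \<ge> 0" for j
    by simp
  have "(\<integral>\<^sup>+j. ennreal (?f j) \<partial>count_space UNIV) = (\<Sum>j<length ps. ennreal (?f j))"
    by (intro nn_integral_count_space') auto
  also have "\<dots> = ennreal (\<Sum>j<length ps. ?f j)"
    by (intro sum_ennreal nn)
  also have "(\<Sum>j<length ps. ?f j) =
      (\<Sum>j<length ps. real (length (ps ! j)) / real (\<Sum>p\<leftarrow>ps. length p))"
    by simp
  also have "\<dots> = real (\<Sum>j<length ps. length (ps ! j)) / real (\<Sum>p\<leftarrow>ps. length p)"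
    by (simp only: sum_divide_distrib of_nat_sum)
  also have "(\<Sum>j<length ps. length (ps ! j)) = (\<Sum>p\<leftarrow>ps. length p)"
    by (simp add: sum_list_sum_nth lessThan_atLeast0)
  also have "real (\<Sum>p\<leftarrow>ps. length p) / real (\<Sum>p\<leftarrow>ps. length p) = 1"
    using assms by (intro divide_self) linarith
  finally show ?thesis
    unfolding drop_index_def by (subst pmf_embed_pmf) (use nn in auto)
qed

end

theory Submission
  imports Defs
begin

text \<open>
  Let \<open>q i\<close> be the probability that the bottom card lands at position \<open>i\<close> from the top.

  The bottom card is the bottom card of the last nonempty packet. If that packet has \<open>B\<close> cards, then
  the card lands at position \<open>i\<close> iff it is the first of the \<open>B\<close> to fall and \<open>i\<close> cards are left at that
  moment, which has probability \<open>((i-1) choose (B-1)) / (n choose B)\<close> (\<open>prob_riffle_position\<close>).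
  Averaging over the cuts and summing by the index \<open>k\<close> of the last nonempty packet (counted from
  \<open>0\<close>), the sum over \<open>B\<close> is a binomial expansion and gives
  \<open>q i = a^(-n) * (\<Sum>k<a. k^(n-i) * (k+1)^(i-1))\<close> (\<open>position_prob_bottom\<close>).

  Since \<open>k \<le> \<alpha> (k+1)\<close> for \<open>k < a\<close>, this formula shows \<open>q i \<le> \<alpha> * q (i+1)\<close>: the sequence \<open>q\<close> climbs at
  least as fast as a geometric one. It therefore lies below the geometric sequence with ratio
  \<open>1/\<alpha>\<close> through its last value and above the one through its first value. Both end values
  are under control: summing \<open>q i \<le> \<alpha>^(n-i) * q n\<close> to \<open>1\<close> bounds \<open>q n\<close> from below, the inequality
  \<open>1 - j/a \<le> \<alpha>^j\<close> bounds it from above, and \<open>q 1 = q n - 1/a\<close> by telescoping. Altogether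
    \<open>\<alpha>^(n+1-i) / (a (1-\<alpha>^n)) \<le> q i \<le> \<alpha>^(n-i) / (a (1-\<alpha>^(n-1)))\<close>
  (\<open>bottom_prob_ge\<close>, \<open>bottom_prob_le\<close>).

  As \<open>q\<close> is increasing, its total variation distance from uniform is the largest value over
  \<open>s \<le> n\<close> of \<open>\<Sum>i=1..s. 1/n - q i\<close>. With a geometric sequence in place of \<open>q\<close> this deficit is an
  explicit function of \<open>s\<close>, essentially \<open>s/n - (a/n) * \<alpha>^(x-s)\<close>, where \<open>x\<close> is the real number at
  which the geometric sequence crosses the level \<open>1/n\<close>. The logarithmic terms of the two bounds are
  \<open>x/n\<close> in the upper and \<open>(x-1)/n\<close> in the lower one. For the upper bound the function
  is bounded over all real \<open>s\<close>; for the lower bound the integer part of \<open>x\<close> is inserted, or \<open>0\<close> if \<open>x\<close> is negative.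
\<close>

section \<open>The fall of a bottom card in a riffle\<close>

lemma prob_bind_pmf_finite:
  assumes "finite S" "set_pmf p \<subseteq> S"
  shows "measure_pmf.prob (bind_pmf p f) X = (\<Sum>x\<in>S. pmf p x * measure_pmf.prob (f x) X)"
proof -
  have "measure_pmf.prob (bind_pmf p f) X = (\<integral>x. measure_pmf.prob (f x) X \<partial>measure_pmf p)"
    unfolding measure_pmf_bind
    by (subst measure_pmf.measure_bind[where N = "count_space UNIV"])
      (auto simp: measurable_def space_subprob_algebra
        intro!: prob_space_imp_subprob_space measure_pmf.prob_space_axioms)
  also have "\<dots> = (\<Sum>x\<in>S. pmf p x * measure_pmf.prob (f x) X)"
    using assms by (subst integral_measure_pmf[of S]) (auto simp: set_pmf_iff)
  finally show ?thesis .
qed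

lemma set_pmf_drop_index:
  assumes "(\<Sum>p\<leftarrow>ps. length p) > 0"
  shows "set_pmf (drop_index ps) = {j. j < length ps \<and> ps ! j \<noteq> []}"
  using assms by (force simp: set_pmf_iff pmf_drop_index split: if_splits)

lemma sum_length_drop:
  assumes "j < length ps" "ps ! j \<noteq> []"
  shows "Suc (\<Sum>p\<leftarrow>ps[j := butlast (ps ! j)]. length p) = (\<Sum>p\<leftarrow>ps. length p)"
  using assms
proof (induction ps arbitrary: j)
  case (Cons p ps)
  then show ?case by (cases j) auto
qed simp

lemma set_pmf_riffle:
  assumes "e \<in> set_pmf (riffle m ps d)" "(\<Sum>p\<leftarrow>ps. length p) = m"
  shows "\<exists>u. e = u @ d \<and> length u = m \<and> set u \<subseteq> (\<Union>p\<in>set ps. set p)"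
  using assms
proof (induction m arbitrary: ps d)
  case (Suc m)
  then obtain j where j: "j < length ps" "ps ! j \<noteq> []"
    and e: "e \<in> set_pmf (riffle m (ps[j := butlast (ps ! j)]) (last (ps ! j) # d))"
    by (auto simp: set_pmf_drop_index)
  have "(\<Sum>p\<leftarrow>ps[j := butlast (ps ! j)]. length p) = m"
    using sum_length_drop[OF j] Suc.prems(2) by simp
  then obtain u where u: "e = u @ last (ps ! j) # d" "length u = m"
      "set u \<subseteq> (\<Union>p\<in>set (ps[j := butlast (ps ! j)]). set p)"
    using Suc.IH[OF e] by blast
  have "(\<Union>p\<in>set (ps[j := butlast (ps ! j)]). set p) \<subseteq> (\<Union>p\<in>set ps. set p)"
    using j set_update_subset_insert[of ps j "butlast (ps ! j)"]
    by (fastforce dest: in_set_butlastD)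
  moreover have "last (ps ! j) \<in> (\<Union>p\<in>set ps. set p)"
    using j nth_mem last_in_set by blast
  ultimately show ?case
    using u by (intro exI[of _ "u @ [last (ps ! j)]"]) auto
qed auto

lemma pmf_drop_index_others:
  assumes "(\<Sum>p\<leftarrow>ps. length p) = m" "m > 0" "j < length ps"
  shows "(\<Sum>k\<in>{..<length ps} - {j}. pmf (drop_index ps) k) = 1 - real (length (ps ! j)) / real m"
proof -
  have "(\<Sum>k<length ps. pmf (drop_index ps) k) = 1"
    using assms by (intro sum_pmf_eq_1) (auto simp: set_pmf_drop_index)
  moreover have "pmf (drop_index ps) j = real (length (ps ! j)) / real m"
    using assms by (simp add: pmf_drop_index)
  ultimately show ?thesis
    using assms(3) by (simp add: sum_diff1)
qed

text \<open>
  The card \<open>c\<close> at the bottom of a packet of \<open>B\<close> cards is the first of its packet to fall, and once it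
  falls with \<open>i\<close> cards left (itself included), the other \<open>i - 1\<close> end up above it. Among the
  \<open>m choose B\<close> equally likely sets of final positions of the packet, those with largest element \<open>i\<close>
  number \<open>(i-1) choose (B-1)\<close>. In the induction over the drops, the first card to fall decides whether
  \<open>c\<close> is at position \<open>m\<close>; for smaller \<open>i\<close> some other packet must drop first, and packet sizes are
  then as before except that one card fewer is left in total.
\<close>

lemma prob_riffle_position:
  assumes "(\<Sum>p\<leftarrow>ps. length p) = m" "j < length ps" "ps ! j \<noteq> []" "last (ps ! j) = c"
    "c \<notin> set (butlast (ps ! j))" "\<And>k. k < length ps \<Longrightarrow> k \<noteq> j \<Longrightarrow> c \<notin> set (ps ! k)"
    "1 \<le> i" "i \<le> m"
  shows "measure_pmf.prob (riffle m ps d) {e. e ! (i - 1) = c} =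
    real ((i - 1) choose (length (ps ! j) - 1)) / real (m choose length (ps ! j))"
  using assms
proof (induction m arbitrary: ps d)
  case (Suc m)
  define B where "B = length (ps ! j)"
  define ps' where "ps' = (\<lambda>k. ps[k := butlast (ps ! k)])"
  define R where "R = (\<lambda>k. measure_pmf.prob (riffle m (ps' k) (last (ps ! k) # d)) {e. e ! (i - 1) = c})"
  note pm = pmf_drop_index[of ps]
  have B: "B > 0" using Suc.prems by (simp add: B_def)
  have BS: "B \<le> Suc m"
    using member_le_sum_list[of B "map length ps"] Suc.prems by (auto simp: B_def)
  have tot: "(\<Sum>p\<leftarrow>ps' k. length p) = m" if "k < length ps" "ps ! k \<noteq> []" for k
    using sum_length_drop[OF that] Suc.prems(1) by (simp add: ps'_def)
  have "measure_pmf.prob (riffle (Suc m) ps d) {e. e ! (i - 1) = c}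
      = (\<Sum>k<length ps. pmf (drop_index ps) k * R k)"
    unfolding R_def ps'_def using Suc.prems
    by (simp only: riffle.simps, intro prob_bind_pmf_finite) (auto simp: set_pmf_drop_index)
  also have "\<dots> = pmf (drop_index ps) j * R j
      + (\<Sum>k\<in>{..<length ps} - {j}. pmf (drop_index ps) k * R k)"
    using Suc.prems(2) by (intro sum.remove) auto
  also have "pmf (drop_index ps) j = real B / real (Suc m)"
    using Suc.prems by (simp add: pm B_def)
  finally have split: "measure_pmf.prob (riffle (Suc m) ps d) {e. e ! (i - 1) = c} =
      real B / real (Suc m) * R j + (\<Sum>k\<in>{..<length ps} - {j}. pmf (drop_index ps) k * R k)" .
  have others: "(\<Sum>k\<in>{..<length ps} - {j}. pmf (drop_index ps) k * R k) = (1 - real B / real (Suc m)) * r"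
    if "\<And>k. k < length ps \<Longrightarrow> ps ! k \<noteq> [] \<Longrightarrow> k \<noteq> j \<Longrightarrow> R k = r" for r
  proof -
    have "(\<Sum>k\<in>{..<length ps} - {j}. pmf (drop_index ps) k * R k) =
        (\<Sum>k\<in>{..<length ps} - {j}. pmf (drop_index ps) k * r)"
      using that Suc.prems by (intro sum.cong refl) (auto simp: pm)
    also have "\<dots> = (\<Sum>k\<in>{..<length ps} - {j}. pmf (drop_index ps) k) * r"
      by (simp add: sum_distrib_right)
    finally show ?thesis
      using pmf_drop_index_others[of ps "Suc m" j] Suc.prems by (simp add: B_def)
  qed
  show ?case
  proof (cases "i = Suc m")
    case True
    have at: "e ! m = last (ps ! k)"
      if "e \<in> set_pmf (riffle m (ps' k) (last (ps ! k) # d))" "k < length ps" "ps ! k \<noteq> []" for e k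
      using set_pmf_riffle[OF that(1) tot[OF that(2,3)]] by (auto simp: nth_append)
    have "R j = 1"
      unfolding R_def using at[of _ j] Suc.prems True by (subst measure_pmf.prob_eq_1) (auto simp: AE_measure_pmf_iff)
    moreover have "R k = 0" if "k < length ps" "ps ! k \<noteq> []" "k \<noteq> j" for k
    proof -
      have "last (ps ! k) \<noteq> c"
        using Suc.prems(6)[of k] that last_in_set[of "ps ! k"] by auto
      then show ?thesis
        unfolding R_def using at[of _ k] that True by (subst measure_pmf_zero_iff) auto
    qed
    ultimately have "measure_pmf.prob (riffle (Suc m) ps d) {e. e ! (i - 1) = c} = real B / real (Suc m)"
      using split others[of 0] by simp
    also have "\<dots> = real (m choose (B - 1)) / real (Suc m choose B)"
    proof -
      have "real B * real (Suc m choose B) = real (Suc m) * real (m choose (B - 1))"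
        using Suc_times_binomial_eq[of m "B - 1"] B by (simp flip: of_nat_mult del: of_nat_Suc)
      then show ?thesis using BS by (simp add: field_simps del: of_nat_Suc)
    qed
    finally show ?thesis using True by (simp add: B_def)
  next
    case False
    with Suc.prems have i: "i \<le> m" by simp
    have "R j = 0"
    proof -
      have "e ! (i - 1) \<noteq> c" if e: "e \<in> set_pmf (riffle m (ps' j) (last (ps ! j) # d))" for e
      proof -
        obtain u where u: "e = u @ last (ps ! j) # d" "length u = m"
            "set u \<subseteq> (\<Union>p\<in>set (ps' j). set p)"
          using set_pmf_riffle[OF e tot[OF Suc.prems(2,3)]] by blast
        have "c \<notin> set p" if "p \<in> set (ps' j)" for p
        proof -
          obtain k where "k < length ps" "p = ps' j ! k"
            using \<open>p \<in> set (ps' j)\<close> by (auto simp: ps'_def in_set_conv_nth)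
          then show ?thesis
            using Suc.prems(5,6) by (cases "k = j") (auto simp: ps'_def)
        qed
        moreover have "u ! (i - 1) \<in> set u"
          using u(2) i Suc.prems by (intro nth_mem) auto
        then have "u ! (i - 1) \<in> (\<Union>p\<in>set (ps' j). set p)"
          using u(3) by blast
        ultimately have "u ! (i - 1) \<noteq> c" by blast
        then show ?thesis
          using u(1,2) i Suc.prems by (auto simp: nth_append)
      qed
      then show ?thesis unfolding R_def by (subst measure_pmf_zero_iff) auto
    qed
    moreover have "R k = real ((i - 1) choose (B - 1)) / real (m choose B)"
      if k: "k < length ps" "ps ! k \<noteq> []" "k \<noteq> j" for k
    proof -
      have eq: "ps' k ! j = ps ! j" using k by (simp add: ps'_def)
      have "c \<notin> set (ps' k ! l)" if "l < length (ps' k)" "l \<noteq> j" for l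
        using that Suc.prems(6) k by (auto simp: ps'_def nth_list_update dest: in_set_butlastD)
      then have "R k = real ((i - 1) choose (length (ps' k ! j) - 1)) / real (m choose length (ps' k ! j))"
        unfolding R_def using Suc.prems k i tot[of k] by (intro Suc.IH) (auto simp: eq, auto simp: ps'_def)
      then show ?thesis by (simp add: eq B_def)
    qed
    ultimately have "measure_pmf.prob (riffle (Suc m) ps d) {e. e ! (i - 1) = c} =
        (1 - real B / real (Suc m)) * (real ((i - 1) choose (B - 1)) / real (m choose B))"
      using split others by simp
    also have "\<dots> = real ((i - 1) choose (B - 1)) / real (Suc m choose B)"
    proof (cases "B = Suc m")
      case True
      then show ?thesis using i Suc.prems(7) by (simp add: binomial_eq_0)
    next
      case False
      then have "B \<le> m" using BS by simp
      have "real (Suc m - B) * real (Suc m choose B) = real (Suc m) * real (m choose B)"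
        using binomial_absorb_comp[of "Suc m" B] by (simp flip: of_nat_mult del: of_nat_Suc)
      then have "(real (Suc m) - real B) * real (Suc m choose B) = real (Suc m) * real (m choose B)"
        using BS by (simp add: of_nat_diff del: of_nat_Suc)
      moreover have "real (m choose B) > 0" "real (Suc m choose B) > 0"
        using \<open>B \<le> m\<close> by auto
      ultimately have "1 - real B / real (Suc m) = real (m choose B) / real (Suc m choose B)"
        by (simp add: field_simps del: of_nat_Suc binomial_Suc_Suc)
      then show ?thesis
        using \<open>real (m choose B) > 0\<close> by (simp del: of_nat_Suc binomial_Suc_Suc)
    qed
    finally show ?thesis by (simp add: B_def)
  qed
qed simp

section \<open>The position of the bottom card after a shuffle\<close>

definition last_nonempty_size :: "nat list \<Rightarrow> nat" where
  "last_nonempty_size A = last (filter (\<lambda>k. k > 0) A)"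

lemma map_length_cut: "sum_list A \<le> length d \<Longrightarrow> map length (cut A d) = A"
  by (induction A arbitrary: d) auto

lemma concat_cut: "sum_list A = length d \<Longrightarrow> concat (cut A d) = d"
  by (induction A arbitrary: d) auto

text \<open>
  Empty packets at the end contribute nothing to the concatenation, so the bottom of the deck is the
  bottom of the last nonempty packet.
\<close>

lemma last_nonempty_packet:
  assumes "concat ps \<noteq> []"
  obtains j where "j < length ps" "ps ! j \<noteq> []" "last (ps ! j) = last (concat ps)"
    "last_nonempty_size (map length ps) = length (ps ! j)"
  using assms
proof (induction ps arbitrary: thesis rule: rev_induct)
  case (snoc p ps)
  show ?case
  proof (cases "p = []")
    case True
    with snoc.prems(2) have "concat ps \<noteq> []" by simp
    then obtain j where "j < length ps" "ps ! j \<noteq> []" "last (ps ! j) = last (concat ps)"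
      "last_nonempty_size (map length ps) = length (ps ! j)"
      using snoc.IH by blast
    then show ?thesis
      using True by (intro snoc.prems(1)[of j]) (auto simp: nth_append last_nonempty_size_def)
  next
    case False
    then show ?thesis
      by (intro snoc.prems(1)[of "length ps"]) (auto simp: last_nonempty_size_def)
  qed
qed simp

lemma prob_riffle_cut:
  assumes "distinct d" "d \<noteq> []" "sum_list A = length d" "1 \<le> i" "i \<le> length d"
  shows "measure_pmf.prob (riffle (length d) (cut A d) []) {e. e ! (i - 1) = last d} =
    real ((i - 1) choose (last_nonempty_size A - 1)) / real (length d choose last_nonempty_size A)"
proof -
  define ps where "ps = cut A d"
  have len: "map length ps = A" and cc: "concat ps = d"
    unfolding ps_def using assms by (auto intro: map_length_cut concat_cut)
  obtain j where j: "j < length ps" "ps ! j \<noteq> []" "last (ps ! j) = last d"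
      "last_nonempty_size A = length (ps ! j)"
    using last_nonempty_packet[of ps] len cc assms(2) by auto
  have ps: "ps = take j ps @ ps ! j # drop (Suc j) ps"
    using j(1) by (rule id_take_nth_drop)
  have "distinct (concat (take j ps @ ps ! j # drop (Suc j) ps))"
    using cc ps assms(1) by simp
  then have dist: "distinct (ps ! j)" "set (ps ! j) \<inter> set (concat (take j ps)) = {}"
      "set (ps ! j) \<inter> set (concat (drop (Suc j) ps)) = {}"
    by auto
  have c: "last d \<in> set (ps ! j)" using j last_in_set by metis
  have "last d \<notin> set (butlast (ps ! j))"
    using dist(1) j(2,3) by (metis append_butlast_last_id distinct_butlast not_distinct_conv_prefix)
  moreover have "last d \<notin> set (ps ! k)" if k: "k < length ps" "k \<noteq> j" for k
  proof (cases "k < j")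
    case True
    then have "ps ! k \<in> set (take j ps)"
      using k by (auto simp: in_set_conv_nth intro!: exI[of _ k])
    then show ?thesis using c dist(2) by auto
  next
    case False
    then have "ps ! k \<in> set (drop (Suc j) ps)"
      using k by (auto simp: in_set_conv_nth intro!: exI[of _ "k - Suc j"])
    then show ?thesis using c dist(3) by auto
  qed
  moreover have "(\<Sum>p\<leftarrow>ps. length p) = length d" using len assms(3) by simp
  ultimately show ?thesis
    using prob_riffle_position[of ps "length d" j "last d" i] j assms by (simp add: ps_def)
qed

text \<open>
  Splitting off the size of the bottom packet, rather than that of the top one, fits the fact
  that only the last nonempty packet matters for the bottom card.
\<close>

lemma packet_sizes_Suc_snoc:
  "packet_sizes (Suc a) n = (\<lambda>(k, A). A @ [k]) ` (SIGMA k:{..n}. packet_sizes a (n - k))"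
proof (intro equalityI subsetI)
  fix B assume B: "B \<in> packet_sizes (Suc a) n"
  then obtain A k where "B = A @ [k]" by (cases B rule: rev_cases) (auto simp: packet_sizes_def)
  with B show "B \<in> (\<lambda>(k, A). A @ [k]) ` (SIGMA k:{..n}. packet_sizes a (n - k))"
    by (intro image_eqI[of _ _ "(k, A)"]) (auto simp: packet_sizes_def)
qed (auto simp: packet_sizes_def)

text \<open>
  Each new packet at the bottom adds one summand: if it is empty, the previous cut is unchanged, and
  if it has \<open>k > 0\<close> cards, it is the last nonempty one. In the latter case the factor \<open>n choose k\<close>
  in the multinomial coefficient cancels the denominator, the upper packets contribute
  \<open>a^(n-k)\<close>, and the sum over \<open>k\<close> is a binomial expansion of \<open>(a+1)^(i-1)\<close>.
\<close>

lemma sum_last_nonempty: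
  assumes "1 \<le> i" "i \<le> n"
  shows "(\<Sum>A\<in>packet_sizes a n. fact n / (\<Prod>k\<leftarrow>A. fact k) *
      (real ((i - 1) choose (last_nonempty_size A - 1)) / real (n choose last_nonempty_size A)))
    = (\<Sum>k<a. real k ^ (n - i) * (real k + 1) ^ (i - 1))"
proof (induction a)
  case 0
  then show ?case using assms by (simp add: packet_sizes_0)
next
  case (Suc a)
  define w where "w = (\<lambda>A. fact n / (\<Prod>k\<leftarrow>A. fact k) *
      (real ((i - 1) choose (last_nonempty_size A - 1)) / real (n choose last_nonempty_size A)))"
  have nz: "w (A @ [k]) = real ((i - 1) choose (k - 1)) * (fact (n - k) / (\<Prod>k\<leftarrow>A. fact k))"
    if "k > 0" "k \<le> n" for A k
    using that by (simp add: w_def last_nonempty_size_def binomial_fact)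
  have "(\<Sum>A\<in>packet_sizes (Suc a) n. w A) =
      (\<Sum>(k, A)\<in>(SIGMA k:{..n}. packet_sizes a (n - k)). w (A @ [k]))"
    unfolding packet_sizes_Suc_snoc
    by (subst sum.reindex) (auto simp: inj_on_def intro!: sum.cong)
  also have "\<dots> = (\<Sum>k\<le>n. \<Sum>A\<in>packet_sizes a (n - k). w (A @ [k]))"
    by (subst sum.Sigma) (auto simp: finite_packet_sizes)
  also have "\<dots> = (\<Sum>A\<in>packet_sizes a n. w (A @ [0])) + (\<Sum>k=1..n. \<Sum>A\<in>packet_sizes a (n - k). w (A @ [k]))"
    by (simp add: atMost_atLeast0 sum.atLeast_Suc_atMost)
  also have "(\<Sum>A\<in>packet_sizes a n. w (A @ [0])) = (\<Sum>A\<in>packet_sizes a n. w A)"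
    by (simp add: w_def last_nonempty_size_def)
  also have "\<dots> = (\<Sum>k<a. real k ^ (n - i) * (real k + 1) ^ (i - 1))"
    unfolding w_def by (rule Suc.IH)
  also have "(\<Sum>k=1..n. \<Sum>A\<in>packet_sizes a (n - k). w (A @ [k]))
      = (\<Sum>k=1..n. real ((i - 1) choose (k - 1)) * real a ^ (n - k))"
    by (intro sum.cong refl) (simp add: nz sum_multinomial flip: sum_distrib_left times_divide_eq_right)
  also have "\<dots> = (\<Sum>k<n. real ((i - 1) choose k) * real a ^ (n - 1 - k))"
    by (intro sum.reindex_bij_witness[of _ Suc "\<lambda>k. k - 1"]) auto
  also have "\<dots> = (\<Sum>k\<le>i - 1. real ((i - 1) choose k) * real a ^ (n - 1 - k))"
    using assms by (intro sum.mono_neutral_right) (auto simp: binomial_eq_0)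
  also have "\<dots> = (\<Sum>k\<le>i - 1. real a ^ (n - i) * (real ((i - 1) choose k) * 1 ^ k * real a ^ (i - 1 - k)))"
    using assms by (intro sum.cong refl) (auto simp: algebra_simps simp flip: power_add)
  also have "\<dots> = real a ^ (n - i) * (real a + 1) ^ (i - 1)"
    by (subst add.commute[of "real a"], subst binomial_ring) (simp add: sum_distrib_left)
  finally show ?case by (simp add: w_def)
qed

text \<open>
  The \<open>k\<close>-th summand, divided by \<open>a^n\<close>, is the probability that the bottom card lands at position \<open>i\<close>
  and the last nonempty packet is the one with index \<open>k\<close>, counted from \<open>0\<close>.
\<close>

definition bottom_prob :: "nat \<Rightarrow> nat \<Rightarrow> nat \<Rightarrow> real" where
  "bottom_prob a n i = (\<Sum>k<a. real k ^ (n - i) * (real k + 1) ^ (i - 1)) / real a ^ n"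

lemma position_prob_bottom:
  assumes "distinct d" "length d = n" "n > 0" "a > 0" "1 \<le> i" "i \<le> n"
  shows "position_prob a d (last d) i = bottom_prob a n i"
proof -
  have "position_prob a d (last d) i = (\<Sum>A\<in>packet_sizes a n. pmf (cut_sizes a n) A *
      measure_pmf.prob (riffle n (cut A d) []) {e. e ! (i - 1) = last d})"
    unfolding position_prob_def a_shuffle_def assms(2) using assms
    by (intro prob_bind_pmf_finite) (auto simp: set_pmf_iff pmf_cut_sizes finite_packet_sizes split: if_splits)
  also have "\<dots> = (\<Sum>A\<in>packet_sizes a n. fact n / (\<Prod>k\<leftarrow>A. fact k) *
      (real ((i - 1) choose (last_nonempty_size A - 1)) / real (n choose last_nonempty_size A)) / real a ^ n)"
  proof (intro sum.cong refl)
    fix A assume A: "A \<in> packet_sizes a n"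
    then have "measure_pmf.prob (riffle n (cut A d) []) {e. e ! (i - 1) = last d} =
        real ((i - 1) choose (last_nonempty_size A - 1)) / real (n choose last_nonempty_size A)"
      using prob_riffle_cut[of d A i] assms by (force simp: packet_sizes_def)
    then show "pmf (cut_sizes a n) A * measure_pmf.prob (riffle n (cut A d) []) {e. e ! (i - 1) = last d} =
        fact n / (\<Prod>k\<leftarrow>A. fact k) *
      (real ((i - 1) choose (last_nonempty_size A - 1)) / real (n choose last_nonempty_size A)) / real a ^ n"
      using A assms by (simp add: pmf_cut_sizes)
  qed
  finally show ?thesis
    unfolding bottom_prob_def using sum_last_nonempty[of i n a] assms
    by (simp only: flip: sum_divide_distrib)
qed

section \<open>Geometric bounds on the position probabilities\<close>

lemma sum_bottom_prob:
  assumes "a > 0" "n > 0"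
  shows "(\<Sum>i=1..n. bottom_prob a n i) = 1"
proof -
  have tel: "(\<Sum>i=1..n. real k ^ (n - i) * (real k + 1) ^ (i - 1)) = real (Suc k) ^ n - real k ^ n" for k
  proof -
    have "(\<Sum>i=1..n. real k ^ (n - i) * (real k + 1) ^ (i - 1)) =
        (\<Sum>p<Suc (n - 1). (real k + 1) ^ p * real k ^ (n - 1 - p))"
      using assms by (intro sum.reindex_bij_witness[of _ Suc "\<lambda>i. i - 1"]) (auto simp: mult.commute)
    also have "\<dots> = (real k + 1) ^ Suc (n - 1) - real k ^ Suc (n - 1)"
      by (simp only: diff_power_eq_sum) simp
    finally show ?thesis using assms by (simp add: add.commute)
  qed
  have "(\<Sum>i=1..n. bottom_prob a n i) =
      (\<Sum>k<a. \<Sum>i=1..n. real k ^ (n - i) * (real k + 1) ^ (i - 1)) / real a ^ n"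
    unfolding bottom_prob_def by (subst sum.swap) (simp add: sum_divide_distrib)
  also have "\<dots> = (\<Sum>k<a. real (Suc k) ^ n - real k ^ n) / real a ^ n"
    by (simp only: tel)
  also have "(\<Sum>k<a. real (Suc k) ^ n - real k ^ n) = real a ^ n"
    using assms by (subst sum_lessThan_telescope) simp
  finally show ?thesis using assms by simp
qed

lemma bottom_prob_nonneg: "bottom_prob a n i \<ge> 0"
  unfolding bottom_prob_def by (intro divide_nonneg_nonneg sum_nonneg) auto

text \<open>
  The inequality holds summand by summand because \<open>k \<le> (1 - 1/a) * (k + 1)\<close> iff \<open>k + 1 \<le> a\<close>.
\<close>

lemma bottom_prob_ratio:
  assumes "a > 0" "1 \<le> i" "i < n"
  shows "bottom_prob a n i \<le> (1 - 1 / real a) * bottom_prob a n (Suc i)"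
proof -
  have "real k ^ (n - i) * (real k + 1) ^ (i - 1) \<le>
      (1 - 1 / real a) * (real k ^ (n - Suc i) * (real k + 1) ^ i)" if "k < a" for k
  proof -
    have "real k \<le> (1 - 1 / real a) * (real k + 1)"
      using that by (simp add: field_simps)
    then have le: "real k * (real k ^ (n - Suc i) * (real k + 1) ^ (i - 1)) \<le>
        (1 - 1 / real a) * (real k + 1) * (real k ^ (n - Suc i) * (real k + 1) ^ (i - 1))"
      by (intro mult_right_mono) auto
    have "n - i = Suc (n - Suc i)" "i = Suc (i - 1)" using assms by auto
    then have pw: "real k ^ (n - i) = real k * real k ^ (n - Suc i)"
      "(real k + 1) ^ i = (real k + 1) * (real k + 1) ^ (i - 1)"
      by (metis power_Suc)+
    show ?thesis using le unfolding pw by (simp only: mult_ac)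
  qed
  then have "(\<Sum>k<a. real k ^ (n - i) * (real k + 1) ^ (i - 1)) \<le>
      (\<Sum>k<a. (1 - 1 / real a) * (real k ^ (n - Suc i) * (real k + 1) ^ i))"
    by (intro sum_mono) auto
  then show ?thesis
    using assms by (simp add: bottom_prob_def divide_right_mono flip: sum_distrib_left)
qed

lemma bottom_prob_geometric:
  assumes "a > 0" "1 \<le> i" "i \<le> j" "j \<le> n"
  shows "bottom_prob a n i \<le> (1 - 1 / real a) ^ (j - i) * bottom_prob a n j"
  using assms(3,4)
proof (induction j rule: dec_induct)
  case (step j)
  have "bottom_prob a n i \<le> (1 - 1 / real a) ^ (j - i) * bottom_prob a n j"
    using step by simp
  also have "\<dots> \<le> (1 - 1 / real a) ^ (j - i) * ((1 - 1 / real a) * bottom_prob a n (Suc j))"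
    using step assms by (intro mult_left_mono bottom_prob_ratio) auto
  finally show ?case using step by (simp add: Suc_diff_le mult.assoc mult.commute mult.left_commute)
qed simp

lemma bottom_prob_mono:
  assumes "a > 0" "1 \<le> i" "i \<le> j" "j \<le> n"
  shows "bottom_prob a n i \<le> bottom_prob a n j"
proof -
  have "bottom_prob a n i \<le> (1 - 1 / real a) ^ (j - i) * bottom_prob a n j"
    by (rule bottom_prob_geometric[OF assms])
  also have "\<dots> \<le> 1 * bottom_prob a n j"
    using assms by (intro mult_right_mono power_le_one bottom_prob_nonneg) auto
  finally show ?thesis by simp
qed

lemma sum_geometric_positions:
  assumes "a > 0" "s \<le> n"
  shows "(\<Sum>i=1..s. (1 - 1 / real a) ^ (n - i)) = real a * ((1 - 1 / real a) ^ (n - s) - (1 - 1 / real a) ^ n)"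
  using assms(2)
proof (induction s)
  case (Suc s)
  then have "n - s = Suc (n - Suc s)" by simp
  then have "(1 - 1 / real a) ^ (n - s) = (1 - 1 / real a) * (1 - 1 / real a) ^ (n - Suc s)"
    by simp
  moreover have "real a * (1 - 1 / real a) = real a - 1" using assms(1) by (simp add: field_simps)
  ultimately have "real a * (1 - 1 / real a) ^ (n - s) = (real a - 1) * (1 - 1 / real a) ^ (n - Suc s)"
    by (metis mult.assoc)
  then show ?case using Suc by (simp add: algebra_simps)
qed simp

text \<open>
  Were the last value smaller, the geometric sequence that dominates the distribution would have
  total mass below \<open>1\<close>.
\<close>

lemma bottom_prob_last_ge:
  assumes "a > 1" "n > 0"
  shows "bottom_prob a n n \<ge> 1 / (real a * (1 - (1 - 1 / real a) ^ n))"
proof -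
  have "(1 - 1 / real a) ^ n < 1 ^ n" using assms by (intro power_strict_mono) auto
  then have pos: "real a * (1 - (1 - 1 / real a) ^ n) > 0" using assms by simp
  have "1 = (\<Sum>i=1..n. bottom_prob a n i)" using assms by (subst sum_bottom_prob) auto
  also have "\<dots> \<le> (\<Sum>i=1..n. (1 - 1 / real a) ^ (n - i) * bottom_prob a n n)"
    using assms by (intro sum_mono bottom_prob_geometric) auto
  also have "\<dots> = real a * (1 - (1 - 1 / real a) ^ n) * bottom_prob a n n"
    using sum_geometric_positions[of a n n] assms by (simp flip: sum_distrib_right)
  finally show ?thesis using pos by (simp add: field_simps)
qed

text \<open>
  The last value is the sum of \<open>(1 - j/a)^(n-1) / a\<close> over \<open>j < a\<close>. By Bernoulli's inequality
  \<open>1 - j/a \<le> (1 - 1/a)^j\<close>, so it is dominated by a geometric series.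
\<close>

lemma bottom_prob_last_le:
  assumes "a > 1" "n > 1"
  shows "bottom_prob a n n \<le> 1 / (real a * (1 - (1 - 1 / real a) ^ (n - 1)))"
proof -
  define x where "x = (1 - 1 / real a) ^ (n - 1)"
  have "x < 1 ^ (n - 1)" unfolding x_def using assms by (intro power_strict_mono) auto
  then have x: "0 \<le> x" "x < 1" using assms by (auto simp: x_def)
  have "(real (a - Suc j) + 1) ^ (n - 1) \<le> real a ^ (n - 1) * x ^ j" if "j < a" for j
  proof -
    have "1 + real j * (- (1 / real a)) \<le> (1 + - (1 / real a)) ^ j"
      using assms by (intro Bernoulli_inequality) auto
    then have "real a * (1 - real j / real a) \<le> real a * (1 - 1 / real a) ^ j"
      by (intro mult_left_mono) auto
    moreover have "real a * (1 - real j / real a) = real (a - Suc j) + 1"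
      using that by (simp add: field_simps of_nat_diff)
    ultimately have "real (a - Suc j) + 1 \<le> real a * (1 - 1 / real a) ^ j" by simp
    then have "(real (a - Suc j) + 1) ^ (n - 1) \<le> (real a * (1 - 1 / real a) ^ j) ^ (n - 1)"
      by (intro power_mono) auto
    then show ?thesis
      by (simp add: x_def power_mult_distrib mult.commute flip: power_mult)
  qed
  then have "(\<Sum>j<a. (real (a - Suc j) + 1) ^ (n - 1)) \<le> (\<Sum>j<a. real a ^ (n - 1) * x ^ j)"
    by (intro sum_mono) auto
  also have "\<dots> = real a ^ (n - 1) * ((1 - x ^ a) / (1 - x))"
    using x by (simp add: sum_gp_strict flip: sum_distrib_left)
  also have "\<dots> \<le> real a ^ (n - 1) * (1 / (1 - x))"
    using x by (intro mult_left_mono divide_right_mono) auto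
  also have "(\<Sum>j<a. (real (a - Suc j) + 1) ^ (n - 1)) = (\<Sum>k<a. (real k + 1) ^ (n - 1))"
    by (rule sum.nat_diff_reindex)
  finally have "bottom_prob a n n \<le> real a ^ (n - 1) * (1 / (1 - x)) / real a ^ n"
    unfolding bottom_prob_def by (intro divide_right_mono) auto
  also have "real a ^ n = real a * real a ^ (n - 1)"
    using assms by (simp flip: power_Suc)
  finally show ?thesis using assms by (simp add: x_def mult.commute)
qed

lemma bottom_prob_first:
  assumes "a > 0" "n > 1"
  shows "bottom_prob a n 1 = bottom_prob a n n - 1 / real a"
proof -
  have "(\<Sum>k<a. (real k + 1) ^ (n - 1)) - (\<Sum>k<a. real k ^ (n - 1)) =
      (\<Sum>k<a. real (Suc k) ^ (n - 1) - real k ^ (n - 1))"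
    by (simp add: sum_subtractf add.commute)
  also have "\<dots> = real a ^ (n - 1)"
    using assms by (subst sum_lessThan_telescope) simp
  finally have "bottom_prob a n n - bottom_prob a n 1 = real a ^ (n - 1) / real a ^ n"
    by (simp add: bottom_prob_def flip: diff_divide_distrib)
  also have "real a ^ n = real a * real a ^ (n - 1)"
    using assms by (simp flip: power_Suc)
  finally show ?thesis using assms by simp
qed

lemma bottom_prob_le:
  assumes "a > 1" "n > 1" "1 \<le> i" "i \<le> n"
  shows "bottom_prob a n i \<le> (1 - 1 / real a) ^ (n - i) / (real a * (1 - (1 - 1 / real a) ^ (n - 1)))"
proof -
  have "bottom_prob a n i \<le> (1 - 1 / real a) ^ (n - i) * bottom_prob a n n"
    using assms by (intro bottom_prob_geometric) auto
  also have "\<dots> \<le> (1 - 1 / real a) ^ (n - i) * (1 / (real a * (1 - (1 - 1 / real a) ^ (n - 1))))"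
    using assms by (intro mult_left_mono bottom_prob_last_le) auto
  finally show ?thesis by simp
qed

text \<open>
  The bound comes from the first value, which is at least \<open>\<alpha>^n / (a (1-\<alpha>^n))\<close>, by following
  the geometric growth from position \<open>1\<close> up to \<open>i\<close>.
\<close>

lemma bottom_prob_ge:
  assumes "a > 1" "n > 1" "1 \<le> i" "i \<le> n"
  shows "bottom_prob a n i \<ge> (1 - 1 / real a) ^ (n + 1 - i) / (real a * (1 - (1 - 1 / real a) ^ n))"
proof -
  define \<alpha> where "\<alpha> = 1 - 1 / real a"
  have \<alpha>: "0 < \<alpha>" "\<alpha> < 1" using assms by (auto simp: \<alpha>_def)
  then have "\<alpha> ^ n < 1 ^ n" using assms by (intro power_strict_mono) auto
  then have c: "1 - \<alpha> ^ n > 0" by simp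
  have "\<alpha> ^ n / (real a * (1 - \<alpha> ^ n)) = 1 / (real a * (1 - \<alpha> ^ n)) - 1 / real a"
    using assms c by (simp add: field_simps)
  also have "\<dots> \<le> bottom_prob a n 1"
    using bottom_prob_last_ge[of a n] bottom_prob_first[of a n] assms by (simp add: \<alpha>_def)
  also have "\<dots> \<le> \<alpha> ^ (i - 1) * bottom_prob a n i"
    unfolding \<alpha>_def using assms by (intro bottom_prob_geometric) auto
  finally have "\<alpha> ^ n / (real a * (1 - \<alpha> ^ n)) \<le> \<alpha> ^ (i - 1) * bottom_prob a n i" .
  moreover have "\<alpha> ^ n = \<alpha> ^ (i - 1) * \<alpha> ^ (n + 1 - i)"
    using assms by (simp flip: power_add)
  ultimately have "\<alpha> ^ (i - 1) * (\<alpha> ^ (n + 1 - i) / (real a * (1 - \<alpha> ^ n))) \<le> \<alpha> ^ (i - 1) * bottom_prob a n i"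
    by simp
  then have "\<alpha> ^ (n + 1 - i) / (real a * (1 - \<alpha> ^ n)) \<le> bottom_prob a n i"
    using \<alpha> by (simp only: mult_le_cancel_left_pos zero_less_power)
  then show ?thesis by (simp add: \<alpha>_def)
qed

section \<open>Total variation distance from the uniform distribution\<close>

lemma sum_split_at:
  fixes g :: "nat \<Rightarrow> real"
  assumes "s \<le> n"
  shows "(\<Sum>i=1..n. g i) = (\<Sum>i=1..s. g i) + (\<Sum>i=Suc s..n. g i)"
  using assms sum.ub_add_nat[of 1 s g "n - s"] by simp

text \<open>
  A deficit on an initial segment is compensated by an equal excess on the rest, because
  both distributions have mass \<open>1\<close>.
\<close>

lemma twice_deficit:
  fixes f :: "nat \<Rightarrow> real"
  assumes "(\<Sum>i=1..n. f i) = 1" "n > 0" "s \<le> n"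
  shows "2 * (\<Sum>i=1..s. 1 / real n - f i) =
      (\<Sum>i=1..s. 1 / real n - f i) + (\<Sum>i=Suc s..n. f i - 1 / real n)"
proof -
  have "(\<Sum>i=1..n. f i - 1 / real n) = 0"
    using assms by (simp add: sum_subtractf)
  then show ?thesis
    unfolding sum_split_at[OF assms(3)] by (simp add: sum_subtractf)
qed

lemma half_sum_abs_ge:
  fixes f :: "nat \<Rightarrow> real"
  assumes "(\<Sum>i=1..n. f i) = 1" "n > 0" "s \<le> n"
  shows "(\<Sum>i=1..s. 1 / real n - f i) \<le> 1 / 2 * (\<Sum>i=1..n. \<bar>f i - 1 / real n\<bar>)"
proof -
  have "2 * (\<Sum>i=1..s. 1 / real n - f i) =
      (\<Sum>i=1..s. 1 / real n - f i) + (\<Sum>i=Suc s..n. f i - 1 / real n)"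
    by (rule twice_deficit) (use assms in auto)
  also have "\<dots> \<le> (\<Sum>i=1..s. \<bar>f i - 1 / real n\<bar>) + (\<Sum>i=Suc s..n. \<bar>f i - 1 / real n\<bar>)"
    by (intro add_mono sum_mono) auto
  finally show ?thesis unfolding sum_split_at[OF assms(3)] by simp
qed

text \<open>
  For an increasing sequence the positions of probability at most \<open>1/n\<close> form an initial segment, and
  the deficit on it is the total variation distance.
\<close>

lemma half_sum_abs_mono:
  fixes f :: "nat \<Rightarrow> real"
  assumes "(\<Sum>i=1..n. f i) = 1" "n > 0" "\<And>i j. 1 \<le> i \<Longrightarrow> i \<le> j \<Longrightarrow> j \<le> n \<Longrightarrow> f i \<le> f j"
  obtains s where "s \<le> n" "1 / 2 * (\<Sum>i=1..n. \<bar>f i - 1 / real n\<bar>) = (\<Sum>i=1..s. 1 / real n - f i)"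
proof -
  define s where "s = card {i\<in>{1..n}. f i \<le> 1 / real n}"
  have "s \<le> card {1..n}" unfolding s_def by (intro card_mono) auto
  then have sn: "s \<le> n" by simp
  have le: "f i \<le> 1 / real n" if "1 \<le> i" "i \<le> s" for i
  proof (rule ccontr)
    assume "\<not> f i \<le> 1 / real n"
    then have "j < i" if "j \<le> n" "f j \<le> 1 / real n" for j
      using assms(3)[of i j] that \<open>1 \<le> i\<close> by (cases "i \<le> j") auto
    then have "{i\<in>{1..n}. f i \<le> 1 / real n} \<subseteq> {1..<i}" by auto
    then have "s \<le> card {1..<i}" unfolding s_def by (intro card_mono) auto
    then show False using that by simp
  qed
  have ge: "f i \<ge> 1 / real n" if "s < i" "i \<le> n" for i
  proof (rule ccontr)
    assume "\<not> f i \<ge> 1 / real n"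
    then have "{1..i} \<subseteq> {i\<in>{1..n}. f i \<le> 1 / real n}"
      using assms(3)[of _ i] that by force
    then have "card {1..i} \<le> s" unfolding s_def by (intro card_mono) auto
    then show False using that by simp
  qed
  have "2 * (\<Sum>i=1..s. 1 / real n - f i) =
      (\<Sum>i=1..s. 1 / real n - f i) + (\<Sum>i=Suc s..n. f i - 1 / real n)"
    by (rule twice_deficit) (use assms sn in auto)
  also have "\<dots> = (\<Sum>i=1..s. \<bar>f i - 1 / real n\<bar>) + (\<Sum>i=Suc s..n. \<bar>f i - 1 / real n\<bar>)"
    using le ge by (intro arg_cong2[of _ _ _ _ "(+)"] sum.cong) auto
  finally have "1 / 2 * (\<Sum>i=1..n. \<bar>f i - 1 / real n\<bar>) = (\<Sum>i=1..s. 1 / real n - f i)"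
    unfolding sum_split_at[OF sn] by simp
  then show ?thesis using that sn by blast
qed

section \<open>The two bounds\<close>

text \<open>
  The left-hand side is convex in \<open>\<delta>\<close> with minimum \<open>(1 + ln (a L)) / L\<close>, attained where
  \<open>a L exp (- L \<delta>) = 1\<close>. The minimum is at least \<open>a - 1\<close> because \<open>1/a \<le> L \<le> 1/(a-1)\<close>.
\<close>

lemma offset_plus_exp_ge:
  fixes a :: real
  assumes "a > 1" "L = ln (1 / (1 - 1 / a))"
  shows "\<delta> + a * exp (- L * \<delta>) \<ge> a - 1"
proof -
  have L: "L = - ln (1 - 1 / a)" using assms by (simp add: ln_div)
  have "ln (1 - 1 / a) \<le> - (1 / a)" using ln_le_minus_one[of "1 - 1 / a"] assms by simp
  then have "1 / a \<le> L" unfolding L by simp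
  then have aL: "a * L \<ge> 1" using assms(1) by (simp add: field_simps)
  then have Lpos: "L > 0" using assms by (metis zero_less_mult_pos less_le_trans zero_less_one order.strict_trans)
  have "L = ln (a / (a - 1))" using assms by (simp add: field_simps)
  also have "\<dots> \<le> a / (a - 1) - 1" using assms by (intro ln_le_minus_one) auto
  finally have "L * (a - 1) \<le> 1" using assms by (simp add: field_simps)
  then have inv: "a - 1 \<le> 1 / L" using Lpos by (simp add: field_simps)
  \<comment> \<open>The tangent of the exponential function at the minimum point.\<close>
  have "1 + (ln (a * L) - L * \<delta>) \<le> exp (ln (a * L) - L * \<delta>)" by (rule exp_ge_add_one_self)
  also have "\<dots> = a * L * exp (- L * \<delta>)"
    using aL by (simp add: exp_diff exp_minus field_simps)
  finally have "1 - L * \<delta> \<le> a * L * exp (- L * \<delta>)"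
    using ln_ge_zero[OF aL] by linarith
  then have "L * (1 / L) \<le> L * (\<delta> + a * exp (- L * \<delta>))" using Lpos by (simp add: algebra_simps)
  then have "1 / L \<le> \<delta> + a * exp (- L * \<delta>)" using Lpos by (simp only: mult_le_cancel_left_pos)
  then show ?thesis using inv by linarith
qed

text \<open>
  The left-hand side is convex in \<open>\<delta>\<close>, and it equals \<open>a\<close> at both \<open>\<delta> = 0\<close> and \<open>\<delta> = 1\<close>.
\<close>

lemma offset_plus_exp_le:
  fixes a :: real
  assumes "a > 1" "L = ln (1 / (1 - 1 / a))" "0 \<le> \<delta>" "\<delta> \<le> 1"
  shows "\<delta> + a * exp (- L * \<delta>) \<le> a"
proof -
  have "exp (- L * \<delta>) = (1 - 1 / a) powr \<delta>"
    using assms by (simp add: powr_def ln_div mult.commute)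
  also have "\<dots> \<le> 1 - \<delta> * (1 / a)"
  proof -
    have "convex_on UNIV (exp :: real \<Rightarrow> real)" by (rule exp_convex)
    then have "exp ((1 - \<delta>) *\<^sub>R 0 + \<delta> *\<^sub>R (ln (1 - 1 / a))) \<le> (1 - \<delta>) * exp 0 + \<delta> * exp (ln (1 - 1 / a))"
      using assms by (intro convex_onD) auto
    then show ?thesis using assms by (simp add: powr_def algebra_simps)
  qed
  finally have "a * exp (- L * \<delta>) \<le> a * (1 - \<delta> * (1 / a))" using assms by (intro mult_left_mono) auto
  then show ?thesis using assms by (simp add: algebra_simps)
qed

text \<open>
  Here \<open>x\<close> is the real number with \<open>\<alpha> powr (m - x) = y\<close>. The lemma says \<open>\<alpha>^(m-s) = y * \<alpha> powr (x-s)\<close>,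
  multiplied by \<open>\<alpha>^N\<close> so that all exponents on the left are natural numbers.
\<close>

lemma power_relative_to_level:
  fixes \<alpha> :: real
  assumes "0 < \<alpha>" "\<alpha> < 1" "L = ln (1 / \<alpha>)" "y > 0" "x = ln (y / \<alpha> ^ m) / L" "s \<le> N"
  shows "\<alpha> ^ (N - s) * \<alpha> ^ m = \<alpha> ^ N * (y * exp (- L * (x - real s)))"
proof -
  have L: "L = - ln \<alpha>" "L > 0" using assms by (auto simp: ln_div)
  have "L * x = ln (y / \<alpha> ^ m)" using L assms(5) by simp
  then have ex: "exp (L * x) = y / \<alpha> ^ m" using assms by simp
  have "exp (- (L * real s)) = exp (real s * ln \<alpha>)" by (simp add: L mult.commute)
  then have es: "exp (L * real s) * \<alpha> ^ s = 1"
    using assms by (simp add: exp_of_nat_mult exp_minus field_simps)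
  have "exp (- L * (x - real s)) = exp (L * real s) / exp (L * x)"
    by (simp only: flip: exp_diff) (simp add: algebra_simps)
  then have "y * exp (- L * (x - real s)) = exp (L * real s) * \<alpha> ^ m"
    using ex assms(1,4) by simp
  moreover have "\<alpha> ^ N = \<alpha> ^ (N - s) * \<alpha> ^ s" using assms by (simp flip: power_add)
  ultimately have "\<alpha> ^ N * (y * exp (- L * (x - real s))) = \<alpha> ^ (N - s) * \<alpha> ^ m * (exp (L * real s) * \<alpha> ^ s)"
    by (simp add: mult_ac)
  then show ?thesis by (simp add: es)
qed

text \<open>
  With \<open>s\<close> the number of positions of probability at most \<open>1/n\<close>, the distance is the deficit of the
  first \<open>s\<close> positions, which grows if the probabilities are replaced by their geometric lower
  bounds. At the crossing point \<open>x\<close> these bounds reach \<open>1/n\<close>. The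
  estimate of the deficit is uniform in the offset \<open>x - s\<close>, which can be any real number.
\<close>

lemma total_variation_upper:
  assumes "a > 1" "n > 1" and \<alpha>_def: "\<alpha> = 1 - 1 / real a"
  shows "1 / 2 * (\<Sum>i=1..n. \<bar>bottom_prob a n i - 1 / real n\<bar>) \<le>
      \<alpha> ^ (n + 1) / (1 - \<alpha> ^ n)
      - real a * \<alpha>\<^sup>2 * (1 - \<alpha> ^ (n - 1)) / (real n * (1 - \<alpha> ^ n))
      + 1 / (real n * ln (1 / \<alpha>)) * ln (real a / real n * ((1 - \<alpha> ^ n) / \<alpha> ^ (n + 1)))"
proof -
  define c where "c = 1 - \<alpha> ^ n"
  define L where "L = ln (1 / \<alpha>)"
  define x where "x = ln (real a / real n * (c / \<alpha> ^ (n + 1))) / L"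
  have \<alpha>: "0 < \<alpha>" "\<alpha> < 1" using assms by auto
  then have "\<alpha> ^ n < 1 ^ n" using assms by (intro power_strict_mono) auto
  then have c: "c > 0" by (simp add: c_def)
  obtain s where s: "s \<le> n" and tv: "1 / 2 * (\<Sum>i=1..n. \<bar>bottom_prob a n i - 1 / real n\<bar>) =
      (\<Sum>i=1..s. 1 / real n - bottom_prob a n i)"
    using half_sum_abs_mono[of "bottom_prob a n" n] sum_bottom_prob[of a n] bottom_prob_mono[of a _ _ n] assms by auto
  define E where "E = exp (- L * (x - real s))"
  have "\<alpha> ^ (n - s) * \<alpha> ^ (n + 1) = \<alpha> ^ n * (real a / real n * c * E)"
    unfolding E_def using \<alpha> c s assms by (intro power_relative_to_level) (auto simp: L_def x_def)
  then have "\<alpha> ^ n * (\<alpha> * \<alpha> ^ (n - s)) = \<alpha> ^ n * (real a / real n * c * E)"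
    by (simp only: power_add power_one_right mult_ac)
  then have E: "\<alpha> * \<alpha> ^ (n - s) = real a / real n * c * E"
    using \<alpha> by (subst (asm) mult_left_cancel) auto
  have "(\<Sum>i=1..s. 1 / real n - bottom_prob a n i) \<le>
      (\<Sum>i=1..s. 1 / real n - \<alpha> / (real a * c) * \<alpha> ^ (n - i))"
  proof (intro sum_mono diff_left_mono)
    fix i assume i: "i \<in> {1..s}"
    then have "n + 1 - i = Suc (n - i)" using s by auto
    then show "\<alpha> / (real a * c) * \<alpha> ^ (n - i) \<le> bottom_prob a n i"
      using bottom_prob_ge[of a n i] i s assms(1,2) by (simp add: c_def flip: \<alpha>_def)
  qed
  also have "\<dots> = real s / real n - \<alpha> / (real a * c) * (\<Sum>i=1..s. \<alpha> ^ (n - i))"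
    by (simp add: sum_subtractf sum_distrib_left)
  also have "\<alpha> / (real a * c) * (\<Sum>i=1..s. \<alpha> ^ (n - i)) = (\<alpha> * \<alpha> ^ (n - s) - \<alpha> ^ (n + 1)) / c"
    unfolding \<alpha>_def sum_geometric_positions[OF less_trans[OF zero_less_one assms(1)] s]
    using assms(1) by (simp add: right_diff_distrib[of "1 - 1 / real a"])
  also have "real s / real n - (\<alpha> * \<alpha> ^ (n - s) - \<alpha> ^ (n + 1)) / c = \<alpha> ^ (n + 1) / c + (real s - real a * E) / real n"
    unfolding E using c assms(1,2) by (simp add: field_simps)
  also have "\<dots> \<le> \<alpha> ^ (n + 1) / c + (x - real a * \<alpha>\<^sup>2 * ((1 - \<alpha> ^ (n - 1)) / c)) / real n"
  proof (intro add_left_mono divide_right_mono)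
    have off: "real a - 1 \<le> (x - real s) + real a * E"
      unfolding E_def using assms(1) by (intro offset_plus_exp_ge) (auto simp: L_def \<alpha>_def)
    have "\<alpha> ^ n \<le> \<alpha> ^ (n - 1)" using \<alpha> by (intro power_decreasing) auto
    then have "(1 - \<alpha> ^ (n - 1)) / c \<le> 1" using c by (simp add: c_def)
    then have "real a * \<alpha>\<^sup>2 * ((1 - \<alpha> ^ (n - 1)) / c) \<le> real a * \<alpha>\<^sup>2 * 1"
      by (intro mult_left_mono) auto
    also have "\<dots> = (real a - 1) * \<alpha>"
      using assms(1) by (simp add: \<alpha>_def power2_eq_square field_simps)
    also have "\<dots> \<le> (real a - 1) * 1"
      using \<alpha> assms(1) by (intro mult_left_mono) auto
    finally show "real s - real a * E \<le> x - real a * \<alpha>\<^sup>2 * ((1 - \<alpha> ^ (n - 1)) / c)"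
      using off by simp
  qed simp
  also have "\<dots> = \<alpha> ^ (n + 1) / c - real a * \<alpha>\<^sup>2 * (1 - \<alpha> ^ (n - 1)) / (real n * c) + x / real n"
    using c assms(2) by (simp add: field_simps)
  also have "x / real n = 1 / (real n * L) * ln (real a / real n * (c / \<alpha> ^ (n + 1)))"
    by (simp add: x_def)
  finally show ?thesis using tv by (simp add: c_def L_def)
qed

text \<open>
  Every \<open>s \<le> n\<close> gives a lower bound for the distance, namely the deficit of the geometric upper bounds
  on the first \<open>s\<close> positions. These upper bounds cross the level \<open>1/n\<close> at position \<open>x + 1\<close>, so the
  natural choice is the integer part of \<open>x + 1\<close>.
\<close>

lemma total_variation_lower:
  assumes "a > 1" "n > 1" and \<alpha>_def: "\<alpha> = 1 - 1 / real a"
  shows "1 / 2 * (\<Sum>i=1..n. \<bar>bottom_prob a n i - 1 / real n\<bar>) \<ge>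
      \<alpha> ^ n / (1 - \<alpha> ^ (n - 1))
      - real a * (1 - \<alpha> ^ n) / (real n * \<alpha> * (1 - \<alpha> ^ (n - 1)))
      + 1 / (real n * ln (1 / \<alpha>)) * ln (real a / real n * ((1 - \<alpha> ^ (n - 1)) / \<alpha> ^ (n - 1)))"
proof -
  define c where "c = 1 - \<alpha> ^ n"
  define c' where "c' = 1 - \<alpha> ^ (n - 1)"
  define L where "L = ln (1 / \<alpha>)"
  define x where "x = ln (real a / real n * (c' / \<alpha> ^ (n - 1))) / L"
  have \<alpha>: "0 < \<alpha>" "\<alpha> < 1" using assms by auto
  have "\<alpha> ^ (n - 1) < 1 ^ (n - 1)" using \<alpha> assms by (intro power_strict_mono) auto
  then have c': "c' > 0" by (simp add: c'_def)
  have "\<alpha> ^ n \<le> \<alpha> ^ (n - 1)" using \<alpha> by (intro power_decreasing) auto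
  then have cc: "1 \<le> c / c'" using c' by (simp add: c_def c'_def)
  have L: "L > 0" using \<alpha> by (simp add: L_def)
  define E where "E = (\<lambda>s. exp (- L * (x + 1 - real s)))"
  have expL: "exp (- L) = \<alpha>" using \<alpha> by (simp add: L_def ln_div)
  have E: "\<alpha> ^ (n - s) = real a / real n * c' * E s" if "s \<le> n" for s
  proof -
    have "\<alpha> ^ (n - s) * \<alpha> ^ (n - 1) = \<alpha> ^ n * (real a / real n * c' * exp (- L * (x - real s)))"
      using \<alpha> c' that assms by (intro power_relative_to_level) (auto simp: L_def x_def)
    also have "\<alpha> ^ n = \<alpha> * \<alpha> ^ (n - 1)" using assms by (simp flip: power_Suc)
    finally have "\<alpha> ^ (n - 1) * \<alpha> ^ (n - s) =
        \<alpha> ^ (n - 1) * (real a / real n * c' * (\<alpha> * exp (- L * (x - real s))))"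
      by (simp only: mult_ac)
    then have "\<alpha> ^ (n - s) = real a / real n * c' * (\<alpha> * exp (- L * (x - real s)))"
      using \<alpha> by (subst (asm) mult_left_cancel) auto
    also have "\<alpha> * exp (- L * (x - real s)) = E s"
      unfolding E_def expL[symmetric] by (simp add: algebra_simps flip: exp_add)
    finally show ?thesis .
  qed
  have bound: "\<alpha> ^ n / c' + (real s - real a * E s) / real n \<le>
      1 / 2 * (\<Sum>i=1..n. \<bar>bottom_prob a n i - 1 / real n\<bar>)" if s: "s \<le> n" for s
  proof -
    have "\<alpha> ^ n / c' + (real s - real a * E s) / real n = real s / real n - (\<alpha> ^ (n - s) - \<alpha> ^ n) / c'"
      unfolding E[OF s] using c' assms(1,2) by (simp add: field_simps)
    also have "(\<alpha> ^ (n - s) - \<alpha> ^ n) / c' = 1 / (real a * c') * (\<Sum>i=1..s. \<alpha> ^ (n - i))"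
      using sum_geometric_positions[of a s n] s assms(1) by (simp flip: \<alpha>_def)
    also have "real s / real n - 1 / (real a * c') * (\<Sum>i=1..s. \<alpha> ^ (n - i))
        = (\<Sum>i=1..s. 1 / real n - 1 / (real a * c') * \<alpha> ^ (n - i))"
      by (simp add: sum_subtractf sum_distrib_left)
    also have "\<dots> \<le> (\<Sum>i=1..s. 1 / real n - bottom_prob a n i)"
      using bottom_prob_le[of a n] s assms(1,2)
      by (intro sum_mono diff_left_mono) (auto simp: c'_def simp flip: \<alpha>_def)
    also have "\<dots> \<le> 1 / 2 * (\<Sum>i=1..n. \<bar>bottom_prob a n i - 1 / real n\<bar>)"
      using s sum_bottom_prob[of a n] assms(1,2) by (intro half_sum_abs_ge) auto
    finally show ?thesis .
  qed
  have target: "real a \<le> real a / \<alpha> * (c / c')"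
  proof -
    have "real a * 1 \<le> real a / \<alpha> * (c / c')"
      using cc \<alpha> assms(1) by (intro mult_mono) (auto simp: field_simps)
    then show ?thesis by simp
  qed
  obtain s where s: "s \<le> n" "(x + 1 - real s) + real a * E s - 1 \<le> real a / \<alpha> * (c / c')"
  proof (cases "x + 1 \<ge> 0")
    case True
    \<comment> \<open>The crossing point is at most \<open>n\<close>: otherwise all probabilities would be below \<open>1/n\<close>.\<close>
    have "1 = (\<Sum>i=1..n. bottom_prob a n i)" using assms by (subst sum_bottom_prob) auto
    also have "\<dots> \<le> (\<Sum>i=1..n. bottom_prob a n n)"
      using assms by (intro sum_mono bottom_prob_mono) auto
    also have "\<dots> = real n * bottom_prob a n n" by simp
    also have "\<dots> \<le> real n * (1 / (real a * c'))"
      using bottom_prob_last_le[of a n] assms(1,2) by (intro mult_left_mono) (auto simp: c'_def \<alpha>_def)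
    finally have "real a / real n * c' \<le> 1"
      using assms(1,2) c' by (simp add: field_simps)
    then have "\<alpha> ^ (n - n) \<le> 1 * E n"
      unfolding E[OF order_refl] by (intro mult_right_mono) (auto simp: E_def)
    then have "0 \<le> - L * (x + 1 - real n)" by (simp add: E_def)
    then have "x + 1 \<le> real n" using L by (simp add: mult_le_0_iff)
    define s where "s = nat \<lfloor>x + 1\<rfloor>"
    have rs: "real s = of_int \<lfloor>x + 1\<rfloor>"
      unfolding s_def using True by (intro of_nat_nat) (simp only: zero_le_floor)
    have "real s \<le> x + 1" "x + 1 \<le> real s + 1"
      unfolding rs using floor_correct[of "x + 1"] by linarith+
    moreover from this have "s \<le> n" using \<open>x + 1 \<le> real n\<close> by linarith
    moreover have "(x + 1 - real s) + real a * E s \<le> real a"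
      unfolding E_def using assms(1) calculation by (intro offset_plus_exp_le) (auto simp: L_def \<alpha>_def)
    ultimately show ?thesis using target that by fastforce
  next
    case False
    \<comment> \<open>With the crossing point negative, \<open>s = 0\<close> gives the trivial bound \<open>0\<close>, and the claimed bound
      is not positive.\<close>
    have "real n * \<alpha> ^ n = (\<Sum>i=1..n. \<alpha> ^ n)" by simp
    also have "\<dots> \<le> (\<Sum>i=1..n. \<alpha> ^ (n - i))"
      using \<alpha> by (intro sum_mono power_decreasing) auto
    also have "\<dots> = real a * c"
      using sum_geometric_positions[of a n n] assms(1) by (simp add: c_def flip: \<alpha>_def)
    finally have "real n * \<alpha> ^ n \<le> real a * c" .
    moreover have "real n * \<alpha> ^ n = c' * (real a * E 0)"
      using E[of 0] assms(1,2) by simp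
    ultimately have "real a * E 0 \<le> real a * (c / c')" using c' by (simp add: field_simps)
    also have "\<dots> \<le> real a / \<alpha> * (c / c')"
      using \<alpha> cc assms(1) by (intro mult_right_mono) (auto simp: field_simps)
    finally show ?thesis using False that[of 0] by simp
  qed
  have "\<alpha> ^ n / c' - real a * c / (real n * \<alpha> * c') + 1 / (real n * L) * ln (real a / real n * (c' / \<alpha> ^ (n - 1)))
      = \<alpha> ^ n / c' + (x - real a / \<alpha> * (c / c')) / real n"
    by (simp add: x_def diff_divide_distrib mult_ac)
  also have "\<dots> \<le> \<alpha> ^ n / c' + (real s - real a * E s) / real n"
    using s by (intro add_left_mono divide_right_mono) auto
  also have "\<dots> \<le> 1 / 2 * (\<Sum>i=1..n. \<bar>bottom_prob a n i - 1 / real n\<bar>)"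
    by (rule bound[OF s(1)])
  finally show ?thesis by (simp add: c_def c'_def L_def)
qed

theorem proposition2p7:
  fixes n a :: nat and deck :: "'c list" and ace :: 'c and \<alpha> :: real and Q :: "nat \<Rightarrow> real"
  assumes n: "n \<ge> 2" and a: "a \<ge> 2"
    and \<alpha>: "\<alpha> = 1 - 1 / real a"
    and deck: "length deck = n" "distinct deck" "last deck = ace"
    and Q: "\<And>i. 1 \<le> i \<Longrightarrow> i \<le> n \<Longrightarrow> Q i = position_prob a deck ace i"
  shows "((1 / 2) * (\<Sum>i = 1..n. \<bar>Q i - 1 / real n\<bar>) \<le>
      \<alpha> ^ (n + 1) / (1 - \<alpha> ^ n)
      - real a * \<alpha>\<^sup>2 * (1 - \<alpha> ^ (n - 1)) / (real n * (1 - \<alpha> ^ n))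
      + 1 / (real n * ln (1 / \<alpha>)) * ln (real a / real n * ((1 - \<alpha> ^ n) / \<alpha> ^ (n + 1))))
    \<and> ((1 / 2) * (\<Sum>i = 1..n. \<bar>Q i - 1 / real n\<bar>) \<ge>
      \<alpha> ^ n / (1 - \<alpha> ^ (n - 1))
      - real a * (1 - \<alpha> ^ n) / (real n * \<alpha> * (1 - \<alpha> ^ (n - 1)))
      + 1 / (real n * ln (1 / \<alpha>)) * ln (real a / real n * ((1 - \<alpha> ^ (n - 1)) / \<alpha> ^ (n - 1))))"
proof -
  have "deck \<noteq> []" using deck n by auto
  then have "Q i = bottom_prob a n i" if "1 \<le> i" "i \<le> n" for i
    using Q[OF that] position_prob_bottom[of deck n a i] that deck n a by simp
  then have tv: "(\<Sum>i = 1..n. \<bar>Q i - 1 / real n\<bar>) = (\<Sum>i = 1..n. \<bar>bottom_prob a n i - 1 / real n\<bar>)"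
    by (intro sum.cong refl) auto
  show ?thesis
    unfolding tv using total_variation_upper[of a n \<alpha>] total_variation_lower[of a n \<alpha>] n a \<alpha> by simp
qed

end
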